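(* Let $k,a_2$ be real constants. The map $\varphi:(M^2,dr^2+\sigma^2(r)d\theta^2)\to(N^2,d\rho^2+\lambda^2(\rho)d\phi^2)$, $\varphi(r,\theta)=(\rho(r),k\theta+a_2)$, is biharmonic if and only if $\rho=\rho(r)$ solves the system $$\begin{cases} x''+\frac{\sigma'}{\sigma}x'-\frac{k^2(\lambda\lambda')'(\rho)}{\sigma^2}x=0,\\[2pt] x=\tau^1=\rho''+\frac{\sigma'}{\sigma}\rho'-\frac{k^2(\lambda\lambda')(\rho)}{\sigma^2}. \end{cases}$$ In particular, the rotationally symmetric map $\varphi:(T^2,dr^2+d\theta^2)\to(S^2,d\rho^2+\sin^2\rho\,d\phi^2)$ from a flat torus into a sphere with $\varphi(r,\theta)=(\rho(r),k\theta)$ is biharmonic if and only if $$\rho^{(4)}-2k^2\cos(2\rho)\rho''+2k^2\sin(2\rho)\rho'^2+\frac{k^4}{4}\sin(4\rho)=0.$$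
   Context: All objects are smooth. $M^2$ is a rotationally symmetric surface with coordinates $(r,\theta)$, $r$ in an open interval $I$, and metric $dr^2+\sigma^2(r)d\theta^2$ with $\sigma>0$ on $I$; $N^2$ is a rotationally symmetric surface with coordinates $(\rho,\phi)$, $\rho$ in an open interval $J$, and metric $d\rho^2+\lambda^2(\rho)d\phi^2$ with $\lambda>0$ on $J$ (for the sphere, $\lambda=\sin\rho$, $J=(0,\pi)$). Maps are given by their expressions in these coordinates, with $\rho(r)\in J$, and biharmonicity is considered on the coordinate domain. Primes on $\sigma,\rho,x$ denote $d/dr$; $(\lambda\lambda')(\rho)$ and $(\lambda\lambda')'(\rho)$ denote $\lambda\frac{d\lambda}{d\rho}$ and $\frac{d}{d\rho}\left(\lambda\frac{d\lambda}{d\rho}\right)$ evaluated at $\rho=\rho(r)$. $\tau^1$ is the $\partial_\rho$-component of the tension field. The tension field of a map $\varphi:(M,g)\to(N,h)$ is $\tau(\varphi)=\mathrm{Tr}_g\nabla d\varphi$; $\varphi$ is biharmonic if $\tau_2(\varphi)=\mathrm{Tr}_g(\nabla^\varphi\nabla^\varphi-\nabla^\varphi_{\nabla^M})\tau(\varphi)-\mathrm{Tr}_gR^N(d\varphi,\tau(\varphi))d\varphi=0$, where $R^N(X,Y)Z=[\nabla^N_X,\nabla^N_Y]Z-\nabla^N_{[X,Y]}Z$. *)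

theory Defs
  imports "HOL-Analysis.Analysis"
begin

section \<open>Riemannian geometry in a coordinate chart\<close>

text \<open>
  A metric on a chart is a matrix-valued function of the coordinates, and a vector field is given
  by its components with respect to the coordinate frame. All derivatives below only depend on
  the functions near the point of evaluation, so on an open coordinate domain it does not
  matter how the functions are extended outside.
\<close>

type_synonym 'n metric = "real^'n \<Rightarrow> real^'n^'n"
type_synonym 'n vfield = "real^'n \<Rightarrow> real^'n"

definition coord_field :: "'n::finite \<Rightarrow> 'n vfield" where
  "coord_field i = (\<lambda>_. axis i 1)"

definition partial :: "'n::finite \<Rightarrow> (real^'n \<Rightarrow> real) \<Rightarrow> real^'n \<Rightarrow> real" where
  "partial i f p = frechet_derivative f (at p) (axis i 1)"

text \<open>\<open>christoffel g p k i j\<close> is the Christoffel symbol with upper index \<open>k\<close>.\<close>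

definition christoffel :: "'n::finite metric \<Rightarrow> real^'n \<Rightarrow> 'n \<Rightarrow> 'n \<Rightarrow> 'n \<Rightarrow> real" where
  "christoffel g p k i j =
     (1/2) * (\<Sum>l\<in>UNIV. matrix_inv (g p) $ k $ l *
        (partial i (\<lambda>q. g q $ j $ l) p + partial j (\<lambda>q. g q $ i $ l) p
          - partial l (\<lambda>q. g q $ i $ j) p))"

definition conn_form :: "'n::finite metric \<Rightarrow> real^'n \<Rightarrow> real^'n \<Rightarrow> real^'n \<Rightarrow> real^'n" where
  "conn_form g p u v = (\<chi> k. \<Sum>i\<in>UNIV. \<Sum>j\<in>UNIV. christoffel g p k i j * u $ i * v $ j)"

text \<open>The Levi-Civita connection, \<open>nabla g X Y\<close> being the derivative of \<open>Y\<close> in direction \<open>X\<close>.\<close>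

definition nabla :: "'n::finite metric \<Rightarrow> 'n vfield \<Rightarrow> 'n vfield \<Rightarrow> 'n vfield" where
  "nabla g X Y = (\<lambda>p. frechet_derivative Y (at p) (X p) + conn_form g p (X p) (Y p))"

definition lie_bracket :: "'n::finite vfield \<Rightarrow> 'n vfield \<Rightarrow> 'n vfield" where
  "lie_bracket X Y = (\<lambda>p. frechet_derivative Y (at p) (X p) - frechet_derivative X (at p) (Y p))"

definition curvature :: "'n::finite metric \<Rightarrow> 'n vfield \<Rightarrow> 'n vfield \<Rightarrow> 'n vfield \<Rightarrow> 'n vfield" where
  "curvature h X Y Z = (\<lambda>p.
     nabla h X (nabla h Y Z) p - nabla h Y (nabla h X Z) p - nabla h (lie_bracket X Y) Z p)"

text \<open>
  The curvature tensor on tangent vectors at \<open>p\<close>. By tensoriality the extension of the vectors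
  to vector fields is immaterial; the one with constant components is used.
\<close>

definition curv_tensor ::
  "'n::finite metric \<Rightarrow> real^'n \<Rightarrow> real^'n \<Rightarrow> real^'n \<Rightarrow> real^'n \<Rightarrow> real^'n" where
  "curv_tensor h p u v w = curvature h (\<lambda>_. u) (\<lambda>_. v) (\<lambda>_. w) p"

section \<open>Tension field and bitension field\<close>

text \<open>
  Let \<open>F\<close> be a map from a chart with metric \<open>g\<close> to a chart with metric \<open>h\<close>. A vector field along
  \<open>F\<close> (a section of the pull-back of the tangent bundle) has values in the coordinate space of the
  target.
\<close>

definition push_forward :: "(real^'m \<Rightarrow> real^'n) \<Rightarrow> 'm::finite vfield \<Rightarrow> real^'m \<Rightarrow> real^'n::finite" where
  "push_forward F X = (\<lambda>p. frechet_derivative F (at p) (X p))"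

text \<open>The pull-back connection.\<close>

definition nabla_along ::
  "'n::finite metric \<Rightarrow> (real^'m \<Rightarrow> real^'n) \<Rightarrow> 'm::finite vfield \<Rightarrow> (real^'m \<Rightarrow> real^'n)
     \<Rightarrow> real^'m \<Rightarrow> real^'n" where
  "nabla_along h F X V =
     (\<lambda>p. frechet_derivative V (at p) (X p) + conn_form h (F p) (push_forward F X p) (V p))"

text \<open>The trace over \<open>g\<close> of a bilinear form with values \<open>B i j\<close> on the coordinate frame at \<open>p\<close>.\<close>

definition metric_trace ::
  "'m::finite metric \<Rightarrow> real^'m \<Rightarrow> ('m \<Rightarrow> 'm \<Rightarrow> real^'n) \<Rightarrow> real^'n::finite" where
  "metric_trace g p B = (\<Sum>i\<in>UNIV. \<Sum>j\<in>UNIV. (matrix_inv (g p) $ i $ j) *\<^sub>R B i j)"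

definition tension ::
  "'m::finite metric \<Rightarrow> 'n::finite metric \<Rightarrow> (real^'m \<Rightarrow> real^'n) \<Rightarrow> real^'m \<Rightarrow> real^'n" where
  "tension g h F = (\<lambda>p. metric_trace g p (\<lambda>i j.
     nabla_along h F (coord_field i) (push_forward F (coord_field j)) p
       - push_forward F (nabla g (coord_field i) (coord_field j)) p))"

definition bitension ::
  "'m::finite metric \<Rightarrow> 'n::finite metric \<Rightarrow> (real^'m \<Rightarrow> real^'n) \<Rightarrow> real^'m \<Rightarrow> real^'n" where
  "bitension g h F = (\<lambda>p.
     metric_trace g p (\<lambda>i j.
       nabla_along h F (coord_field i) (nabla_along h F (coord_field j) (tension g h F)) p
         - nabla_along h F (nabla g (coord_field i) (coord_field j)) (tension g h F) p)
     - metric_trace g p (\<lambda>i j.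
         curv_tensor h (F p) (push_forward F (coord_field i) p) (tension g h F p)
           (push_forward F (coord_field j) p)))"

text \<open>To be used for maps that are smooth on the open set \<open>U\<close>; smoothness is not part of the definition.\<close>

definition biharmonic_on ::
  "(real^'m) set \<Rightarrow> 'm::finite metric \<Rightarrow> 'n::finite metric \<Rightarrow> (real^'m \<Rightarrow> real^'n) \<Rightarrow> bool" where
  "biharmonic_on U g h F \<longleftrightarrow> (\<forall>p\<in>U. bitension g h F p = 0)"

section \<open>Rotationally symmetric surfaces and maps\<close>

definition open_interval :: "real set \<Rightarrow> bool" where
  "open_interval I \<longleftrightarrow> open I \<and> is_interval I \<and> I \<noteq> {}"

definition smooth_on :: "real set \<Rightarrow> (real \<Rightarrow> real) \<Rightarrow> bool" where
  "smooth_on S f \<longleftrightarrow> (\<forall>n. \<forall>x\<in>S. (deriv ^^ n) f differentiable (at x))"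

text \<open>
  The coordinates of a point \<open>p :: real^2\<close> are the radius \<open>p $ 1\<close> and the angle \<open>p $ 2\<close>. The
  angle ranges over all of \<open>\<real>\<close>, i.e. over the universal cover of the circle, so that
  angular maps with an arbitrary real factor \<open>k\<close> make sense.
\<close>

definition rot_domain :: "real set \<Rightarrow> (real^2) set" where
  "rot_domain I = {p. p $ 1 \<in> I}"

definition rot_metric :: "(real \<Rightarrow> real) \<Rightarrow> 2 metric" where
  "rot_metric \<sigma> p = vector [vector [1, 0], vector [0, (\<sigma> (p $ 1))\<^sup>2]]"

definition rot_map :: "(real \<Rightarrow> real) \<Rightarrow> real \<Rightarrow> real \<Rightarrow> real^2 \<Rightarrow> real^2" where
  "rot_map \<rho> k a p = vector [\<rho> (p $ 1), k * p $ 2 + a]"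

end

theory Submission
  imports Defs
begin

text \<open>
  Along a map \<open>(r, \<theta>) \<mapsto> (\<rho>(r), k \<theta> + a)\<close> between rotationally symmetric surfaces every field
  that arises in the definition of the bitension field has components depending on \<open>r\<close> alone. All
  covariant derivatives therefore reduce to ordinary derivatives in \<open>r\<close> plus Christoffel terms, and
  the only nonzero Christoffel symbols of \<open>dr\<^sup>2 + \<sigma>\<^sup>2 d\<theta>\<^sup>2\<close> are \<open>- \<sigma> \<sigma>'\<close> and \<open>\<sigma>' / \<sigma>\<close>
  (lemma \<open>conn_form_rot_metric\<close>).

  The metric is diagonal, so a trace only involves the two diagonal terms. In the tension field the
  term in direction \<open>\<theta>\<close> contributes \<open>\<sigma>\<^sup>-\<^sup>2 (\<sigma> \<sigma>' \<rho>' - k\<^sup>2 \<lambda> \<lambda>')\<close>, so that the tension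
  field is \<open>x \<partial>\<^sub>\<rho>\<close> with \<open>x\<close> as in the system (\<open>tension_rot_map\<close>). Deriving \<open>x \<partial>\<^sub>\<rho>\<close> twice in
  direction \<open>\<theta>\<close> gives \<open>- k\<^sup>2 (\<lambda>')\<^sup>2 x \<partial>\<^sub>\<rho>\<close>, and the curvature term is \<open>k\<^sup>2 \<lambda> \<lambda>'' x \<partial>\<^sub>\<rho>\<close>
  because the Gauss curvature of the target is \<open>- \<lambda>'' / \<lambda>\<close> (\<open>curv_tensor_rot_metric\<close>). Subtracting
  it leads to the coefficient \<open>(\<lambda>')\<^sup>2 + \<lambda> \<lambda>'' = (\<lambda> \<lambda>')'\<close> of the linear equation, and the bitension field
  again has no angular component (\<open>bitension_rot_map\<close>). Biharmonicity is thus the linear equation for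
  the tension \<open>x\<close>, which is smooth since smooth functions are closed under the operations that form it.

  For the flat torus and the sphere, \<open>\<sigma> = 1\<close> and \<open>\<lambda> \<lambda>' = sin \<rho> cos \<rho> = sin (2 \<rho>) / 2\<close>; inserting \<open>x\<close>
  into the linear equation yields the equation of fourth order.
\<close>

section \<open>Smooth functions of one variable\<close>

lemma smooth_on_deriv:
  assumes "smooth_on S f"
  shows "smooth_on S (deriv f)"
  unfolding smooth_on_def
proof
  fix n
  have "(deriv ^^ n) (deriv f) = (deriv ^^ Suc n) f"
    by (simp only: funpow_Suc_right o_apply)
  then show "\<forall>x\<in>S. (deriv ^^ n) (deriv f) differentiable at x"
    using assms unfolding smooth_on_def by metis
qed

lemma smooth_on_has_real_derivative:
  assumes "smooth_on S f" "x \<in> S"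
  shows "(f has_real_derivative deriv f x) (at x)"
proof -
  have "(deriv ^^ 0) f differentiable at x"
    using assms unfolding smooth_on_def by blast
  then show ?thesis
    by (simp add: DERIV_deriv_iff_real_differentiable)
qed

lemma DERIV_cong_open:
  fixes f g :: "real \<Rightarrow> real"
  assumes "(f has_real_derivative d) (at x)" "open S" "x \<in> S" "\<And>y. y \<in> S \<Longrightarrow> f y = g y"
  shows "(g has_real_derivative d) (at x)"
  using has_field_derivative_transform_within_open[OF assms(1-3)] assms(4) by blast

lemma deriv_cong_open:
  fixes f g :: "real \<Rightarrow> real"
  assumes "open S" "x \<in> S" "\<And>y. y \<in> S \<Longrightarrow> f y = g y"
  shows "deriv f x = deriv g x"
  using assms by (intro deriv_cong_ev) (auto simp: eventually_nhds)

text \<open>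
  Smoothness is a greatest fixed point: a class of functions in which every member has a derivative
  in the class consists of smooth functions. Since a derivative found by calculus rules agrees with
  \<open>deriv\<close> on the open set only, the iterated \<open>deriv\<close> is compared with members of the class there.
\<close>

lemma smooth_on_coinduct:
  assumes "open S" "P f"
    and step: "\<And>f. P f \<Longrightarrow> \<exists>f'. P f' \<and> (\<forall>x\<in>S. (f has_real_derivative f' x) (at x))"
  shows "smooth_on S f"
proof -
  have iter: "\<exists>h. P h \<and> (\<forall>x\<in>S. (deriv ^^ n) f x = h x)" for n
  proof (induction n)
    case 0
    then show ?case using \<open>P f\<close> by auto
  next
    case (Suc n)
    then obtain h where h: "P h" "\<forall>x\<in>S. (deriv ^^ n) f x = h x" by blast
    obtain h' where h': "P h'" "\<forall>x\<in>S. (h has_real_derivative h' x) (at x)"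
      using step[OF h(1)] by blast
    have "(deriv ^^ Suc n) f x = h' x" if "x \<in> S" for x
      using deriv_cong_open[OF \<open>open S\<close> that, of "(deriv ^^ n) f" h] h(2) h'(2) that
      by (auto intro: DERIV_imp_deriv)
    then show ?case using h'(1) by blast
  qed
  show ?thesis
    unfolding smooth_on_def
  proof (intro allI ballI)
    fix n x assume "x \<in> S"
    obtain h where h: "P h" "\<forall>x\<in>S. (deriv ^^ n) f x = h x" using iter by blast
    obtain h' where h': "\<forall>x\<in>S. (h has_real_derivative h' x) (at x)"
      using step[OF h(1)] by blast
    have "((deriv ^^ n) f has_real_derivative h' x) (at x)"
      using h h' \<open>x \<in> S\<close> \<open>open S\<close> DERIV_cong_open[of h "h' x" x S "(deriv ^^ n) f"] by simp
    then show "(deriv ^^ n) f differentiable at x"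
      using real_differentiable_def by blast
  qed
qed

lemma smooth_on_const: "open S \<Longrightarrow> smooth_on S (\<lambda>_. c)"
  by (rule smooth_on_coinduct[where P = "\<lambda>f. \<exists>c. f = (\<lambda>_. c)"])
    (blast, blast, blast intro: DERIV_const)

lemma smooth_on_sin: "open S \<Longrightarrow> smooth_on S sin"
proof (rule smooth_on_coinduct[where P = "\<lambda>f. \<exists>a b. f = (\<lambda>x. a * sin x + b * cos x)"])
  show "\<exists>a b. sin = (\<lambda>x. a * sin x + b * cos x :: real)"
    by (rule exI[of _ 1], rule exI[of _ 0]) simp
next
  fix f :: "real \<Rightarrow> real"
  assume "\<exists>a b. f = (\<lambda>x. a * sin x + b * cos x)"
  then obtain a b where f: "f = (\<lambda>x. a * sin x + b * cos x)" by blast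
  have "(f has_real_derivative (- b) * sin x + a * cos x) (at x)" for x
    unfolding f by (auto intro!: derivative_eq_intros)
  then show "\<exists>f'. (\<exists>a b. f' = (\<lambda>x. a * sin x + b * cos x)) \<and>
      (\<forall>x\<in>S. (f has_real_derivative f' x) (at x))"
    by (intro exI[of _ "\<lambda>x. (- b) * sin x + a * cos x"]) blast
qed

text \<open>
  The closure of the smooth functions under all the operations at once. A derivative of a product,
  an inverse or a composition mixes several operations, so that a single closure serves as the class
  for coinduction where each operation alone would not.
\<close>

inductive smooth_expr :: "real set \<Rightarrow> (real \<Rightarrow> real) \<Rightarrow> bool" for S where
  base: "smooth_on S f \<Longrightarrow> smooth_expr S f"
| add: "smooth_expr S f \<Longrightarrow> smooth_expr S g \<Longrightarrow> smooth_expr S (\<lambda>x. f x + g x)"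
| mult: "smooth_expr S f \<Longrightarrow> smooth_expr S g \<Longrightarrow> smooth_expr S (\<lambda>x. f x * g x)"
| inverse: "smooth_expr S f \<Longrightarrow> \<forall>x\<in>S. f x \<noteq> 0 \<Longrightarrow> smooth_expr S (\<lambda>x. inverse (f x))"
| compose: "smooth_on T f \<Longrightarrow> smooth_expr S g \<Longrightarrow> \<forall>x\<in>S. g x \<in> T \<Longrightarrow> smooth_expr S (\<lambda>x. f (g x))"

lemma smooth_expr_derivative:
  assumes "open S" "smooth_expr S f"
  shows "\<exists>f'. smooth_expr S f' \<and> (\<forall>x\<in>S. (f has_real_derivative f' x) (at x))"
  using assms(2)
proof induction
  case (base f)
  then show ?case
    using smooth_on_deriv smooth_on_has_real_derivative smooth_expr.base by blast
next
  case (add f g)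
  then obtain f' g' where
    "smooth_expr S f'" "\<forall>x\<in>S. (f has_real_derivative f' x) (at x)"
    "smooth_expr S g'" "\<forall>x\<in>S. (g has_real_derivative g' x) (at x)" by blast
  then show ?case
    by (intro exI[of _ "\<lambda>x. f' x + g' x"])
      (auto intro: smooth_expr.add derivative_intros)
next
  case (mult f g)
  then obtain f' g' where *:
    "smooth_expr S f'" "\<forall>x\<in>S. (f has_real_derivative f' x) (at x)"
    "smooth_expr S g'" "\<forall>x\<in>S. (g has_real_derivative g' x) (at x)" by blast
  have "smooth_expr S (\<lambda>x. f' x * g x + g' x * f x)"
    using * mult.hyps by (intro smooth_expr.add smooth_expr.mult)
  then show ?case
    using * by (auto intro: DERIV_mult)
next
  case (inverse f)
  then obtain f' where *:
    "smooth_expr S f'" "\<forall>x\<in>S. (f has_real_derivative f' x) (at x)" by blast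
  have "smooth_expr S (\<lambda>x. (- 1) * (inverse (f x) * f' x * inverse (f x)))"
    using * inverse.hyps \<open>open S\<close>
    by (intro smooth_expr.mult smooth_expr.inverse smooth_expr.base[OF smooth_on_const])
  moreover have "((\<lambda>x. inverse (f x)) has_real_derivative
      (- 1) * (inverse (f x) * f' x * inverse (f x))) (at x)" if "x \<in> S" for x
    using DERIV_inverse'[of f "f' x" x] * inverse.hyps that by simp
  ultimately show ?case by blast
next
  case (compose T f g)
  then obtain g' where *:
    "smooth_expr S g'" "\<forall>x\<in>S. (g has_real_derivative g' x) (at x)" by blast
  have "smooth_expr S (\<lambda>x. deriv f (g x) * g' x)"
    using * compose.hyps
    by (intro smooth_expr.mult smooth_expr.compose[where T = T and f = "deriv f"] smooth_on_deriv)
  moreover have "((\<lambda>x. f (g x)) has_real_derivative deriv f (g x) * g' x) (at x)" if "x \<in> S" for x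
    using DERIV_chain2 smooth_on_has_real_derivative[OF compose.hyps(1)] * compose.hyps that
    by blast
  ultimately show ?case by blast
qed

lemma smooth_expr_imp_smooth_on:
  assumes "open S" "smooth_expr S f"
  shows "smooth_on S f"
  by (rule smooth_on_coinduct[where P = "smooth_expr S", OF assms])
    (rule smooth_expr_derivative[OF assms(1)])

section \<open>Geometry of a rotationally symmetric surface\<close>

lemma vector_2_eq_iff: "(v :: real^2) = vector [a, b] \<longleftrightarrow> v $ 1 = a \<and> v $ 2 = b"
  by (auto simp: vec_eq_iff forall_2)

text \<open>
  Splitting a vector into its axes makes the rules for derivatives of sums applicable.
\<close>

lemma vector_2_axes: "(vector [a, b] :: real^2) = a *\<^sub>R axis 1 1 + b *\<^sub>R axis 2 1"
  by (auto simp: vec_eq_iff forall_2 axis_def)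

lemma open_rot_domain: "open I \<Longrightarrow> open (rot_domain I)"
  unfolding rot_domain_def
  using open_vimage[of I "\<lambda>p::real^2. p $ 1"] by (simp add: vimage_def continuous_on_component)

lemma has_derivative_radial:
  fixes p :: "real^'n"
  assumes "(f has_real_derivative d) (at (p $ i))"
  shows "((\<lambda>q. f (q $ i)) has_derivative (\<lambda>v. d * v $ i)) (at p)"
  using has_derivative_compose[OF bounded_linear_imp_has_derivative[OF bounded_linear_vec_nth]
      assms[unfolded has_field_derivative_def]] by simp

text \<open>
  A vector field is assumed to be radial on the coordinate domain only, because the fields to which
  this is applied are computed with derivatives of \<open>\<sigma>\<close> and \<open>\<rho>\<close>, which are controlled on \<open>I\<close> alone.
\<close>

lemma frechet_derivative_radial_field:
  fixes V :: "real^2 \<Rightarrow> real^2"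
  assumes "open I" "p \<in> rot_domain I"
    and V: "\<And>q. q \<in> rot_domain I \<Longrightarrow> V q = vector [a (q $ 1), b (q $ 1)]"
    and a: "(a has_real_derivative a') (at (p $ 1))"
    and b: "(b has_real_derivative b') (at (p $ 1))"
  shows "frechet_derivative V (at p) v = vector [a' * v $ 1, b' * v $ 1]"
proof -
  from has_derivative_radial[OF a] has_derivative_radial[OF b]
  have "((\<lambda>q. vector [a (q $ 1), b (q $ 1)]) has_derivative
      (\<lambda>v. vector [a' * v $ 1, b' * v $ 1] :: real^2)) (at p)"
    unfolding vector_2_axes by (auto intro!: derivative_intros)
  then have "(V has_derivative (\<lambda>v. vector [a' * v $ 1, b' * v $ 1])) (at p)"
    by (rule has_derivative_transform_within_open[OF _ open_rot_domain[OF assms(1)] assms(2)])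
      (simp add: V)
  from fun_cong[OF frechet_derivative_at[OF this], of v] show ?thesis by simp
qed

lemma frechet_derivative_rot_map:
  assumes "(\<rho> has_real_derivative d) (at (p $ 1))"
  shows "frechet_derivative (rot_map \<rho> k a) (at p) v = vector [d * v $ 1, k * v $ 2]"
proof -
  from has_derivative_radial[OF assms]
  have "(rot_map \<rho> k a has_derivative (\<lambda>v. vector [d * v $ 1, k * v $ 2])) (at p)"
    unfolding rot_map_def vector_2_axes
    by (auto intro!: derivative_eq_intros bounded_linear_imp_has_derivative bounded_linear_vec_nth)
  from fun_cong[OF frechet_derivative_at[OF this], of v] show ?thesis by simp
qed

lemma matrix_inv_unique:
  fixes A B :: "real^'n^'n"
  assumes "A ** B = mat 1" "B ** A = mat 1"
  shows "matrix_inv A = B"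
proof -
  have "matrix_inv A ** A = mat 1"
    unfolding matrix_inv_def using someI[of "\<lambda>C. A ** C = mat 1 \<and> C ** A = mat 1" B] assms by simp
  then have "B = matrix_inv A ** A ** B" by simp
  also have "\<dots> = matrix_inv A"
    using assms by (simp add: matrix_mul_assoc[symmetric])
  finally show ?thesis ..
qed

lemma matrix_inv_rot_metric:
  assumes "\<sigma> (p $ 1) \<noteq> 0"
  shows "matrix_inv (rot_metric \<sigma> p) = vector [vector [1, 0], vector [0, 1 / (\<sigma> (p $ 1))\<^sup>2]]"
    (is "_ = ?B")
proof -
  have "rot_metric \<sigma> p ** ?B = mat 1" "?B ** rot_metric \<sigma> p = mat 1"
    using assms
    by (simp_all add: rot_metric_def matrix_matrix_mult_def vec_eq_iff forall_2 sum_2 mat_def)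
  then show ?thesis by (rule matrix_inv_unique)
qed

lemma metric_trace_rot_metric:
  assumes "\<sigma> (p $ 1) \<noteq> 0"
  shows "metric_trace (rot_metric \<sigma>) p B = B 1 1 + (1 / (\<sigma> (p $ 1))\<^sup>2) *\<^sub>R B 2 2"
  using assms by (simp add: metric_trace_def matrix_inv_rot_metric sum_2)

lemma partial_const: "partial i (\<lambda>_. c) p = 0"
  by (simp add: partial_def)

lemma partial_radial:
  assumes "(f has_real_derivative d) (at (p $ 1))"
  shows "partial i (\<lambda>q::real^2. f (q $ 1)) p = (if i = 1 then d else 0)"
proof -
  from fun_cong[OF frechet_derivative_at[OF has_derivative_radial[OF assms]], of "axis i 1"]
  have "partial i (\<lambda>q::real^2. f (q $ 1)) p = d * (axis i 1 :: real^2) $ 1"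
    unfolding partial_def ..
  then show ?thesis by (simp add: axis_def)
qed

lemma conn_form_rot_metric:
  assumes \<sigma>: "(\<sigma> has_real_derivative d) (at (p $ 1))" "\<sigma> (p $ 1) \<noteq> 0"
  shows "conn_form (rot_metric \<sigma>) p u v =
    vector [- \<sigma> (p $ 1) * d * (u $ 2 * v $ 2), d / \<sigma> (p $ 1) * (u $ 1 * v $ 2 + u $ 2 * v $ 1)]"
proof -
  have "((\<lambda>r. (\<sigma> r)\<^sup>2) has_real_derivative 2 * \<sigma> (p $ 1) * d) (at (p $ 1))"
    using \<sigma>(1) by (auto intro!: derivative_eq_intros)
  note partial = partial_radial[OF this] partial_const
  have entries: "rot_metric \<sigma> q $ 1 $ 1 = 1" "rot_metric \<sigma> q $ 1 $ 2 = 0"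
    "rot_metric \<sigma> q $ 2 $ 1 = 0" "rot_metric \<sigma> q $ 2 $ 2 = (\<sigma> (q $ 1))\<^sup>2" for q
    by (simp_all add: rot_metric_def)
  show ?thesis
    using \<sigma>(2)
    by (simp add: vector_2_eq_iff conn_form_def christoffel_def sum_2 entries partial
        matrix_inv_rot_metric)
      (simp add: power2_eq_square field_simps)
qed

text \<open>
  In dimension two the curvature tensor is \<open>K (\<langle>v, w\<rangle> u - \<langle>u, w\<rangle> v)\<close> with the Gauss curvature
  \<open>K = - \<lambda>'' / \<lambda>\<close>. The right-hand side is this expression with the area form \<open>u\<^sub>1 v\<^sub>2 - u\<^sub>2 v\<^sub>1\<close>
  factored out. Being alternating in \<open>u\<close> and \<open>v\<close>, it vanishes when a tension field along \<open>\<partial>\<^sub>\<rho>\<close>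
  is paired with the image of \<open>\<partial>\<^sub>r\<close>, which is also a multiple of \<open>\<partial>\<^sub>\<rho>\<close>.
\<close>

lemma curv_tensor_rot_metric:
  assumes "open J" "smooth_on J lam" "\<forall>s\<in>J. lam s > 0" "p \<in> rot_domain J"
  shows "curv_tensor (rot_metric lam) p u v w =
    (deriv (deriv lam) (p $ 1) * (u $ 1 * v $ 2 - u $ 2 * v $ 1)) *\<^sub>R
      vector [- lam (p $ 1) * w $ 2, w $ 1 / lam (p $ 1)]"
proof -
  let ?h = "rot_metric lam" and ?s = "p $ 1"
  have s: "?s \<in> J" "lam ?s \<noteq> 0" using assms by (auto simp: rot_domain_def)
  note d1 = smooth_on_has_real_derivative[OF assms(2)]
  note d2 = smooth_on_has_real_derivative[OF smooth_on_deriv[OF assms(2)]]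
  have conn: "conn_form ?h q y z =
      vector [- lam (q $ 1) * deriv lam (q $ 1) * (y $ 2 * z $ 2),
        deriv lam (q $ 1) / lam (q $ 1) * (y $ 1 * z $ 2 + y $ 2 * z $ 1)]"
    if "q \<in> rot_domain J" for q y z
    using conn_form_rot_metric[OF d1, of q] assms(3) that by (force simp: rot_domain_def)
  have nabla_const: "nabla ?h (\<lambda>_. y) (\<lambda>_. z) q = conn_form ?h q y z" for y z q
    by (simp add: nabla_def)
  have second: "nabla ?h (\<lambda>_. x) (nabla ?h (\<lambda>_. y) (\<lambda>_. z)) p =
      vector [- ((deriv lam ?s)\<^sup>2 + lam ?s * deriv (deriv lam) ?s) * (y $ 2 * z $ 2) * x $ 1,
        (deriv (deriv lam) ?s * lam ?s - (deriv lam ?s)\<^sup>2) / (lam ?s)\<^sup>2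
          * (y $ 1 * z $ 2 + y $ 2 * z $ 1) * x $ 1]
      + conn_form ?h p x (conn_form ?h p y z)" for x y z
  proof -
    have a': "((\<lambda>s. - lam s * deriv lam s * (y $ 2 * z $ 2)) has_real_derivative
        - ((deriv lam ?s)\<^sup>2 + lam ?s * deriv (deriv lam) ?s) * (y $ 2 * z $ 2)) (at ?s)"
      using d1[OF s(1)] d2[OF s(1)]
      by (auto intro!: derivative_eq_intros simp: power2_eq_square algebra_simps)
    have b': "((\<lambda>s. deriv lam s / lam s * (y $ 1 * z $ 2 + y $ 2 * z $ 1)) has_real_derivative
        (deriv (deriv lam) ?s * lam ?s - (deriv lam ?s)\<^sup>2) / (lam ?s)\<^sup>2
          * (y $ 1 * z $ 2 + y $ 2 * z $ 1)) (at ?s)"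
      using DERIV_cmult_right[OF DERIV_divide[OF d2[OF s(1)] d1[OF s(1)] s(2)]]
      by (simp add: power2_eq_square)
    have "frechet_derivative (nabla ?h (\<lambda>_. y) (\<lambda>_. z)) (at p) x =
        vector [- ((deriv lam ?s)\<^sup>2 + lam ?s * deriv (deriv lam) ?s) * (y $ 2 * z $ 2) * x $ 1,
          (deriv (deriv lam) ?s * lam ?s - (deriv lam ?s)\<^sup>2) / (lam ?s)\<^sup>2
            * (y $ 1 * z $ 2 + y $ 2 * z $ 1) * x $ 1]"
      by (rule frechet_derivative_radial_field[OF assms(1,4) _ a' b']) (simp add: nabla_const conn)
    then show ?thesis
      by (simp only: nabla_def[of _ _ "nabla ?h (\<lambda>_. y) (\<lambda>_. z)"] nabla_const)
  qed
  have bracket: "nabla ?h (lie_bracket (\<lambda>_. u) (\<lambda>_. v)) (\<lambda>_. w) p = 0"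
    by (simp add: nabla_def lie_bracket_def conn_form_def vec_eq_iff)
  show ?thesis
    unfolding curv_tensor_def curvature_def second bracket conn[OF assms(4)]
    using s(2) by (simp add: vec_eq_iff forall_2, simp add: divide_simps, intro conjI; algebra)
qed

section \<open>Rotationally symmetric maps\<close>

definition radial_tension ::
  "(real \<Rightarrow> real) \<Rightarrow> (real \<Rightarrow> real) \<Rightarrow> (real \<Rightarrow> real) \<Rightarrow> real \<Rightarrow> real \<Rightarrow> real" where
  "radial_tension \<sigma> lam \<rho> k = (\<lambda>r. deriv (deriv \<rho>) r + deriv \<sigma> r / \<sigma> r * deriv \<rho> r
     - k\<^sup>2 * (lam (\<rho> r) * deriv lam (\<rho> r)) / (\<sigma> r)\<^sup>2)"

text \<open>
  The operator of the linear equation. Up to sign it is the Jacobi operator of the map, restricted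
  to the sections \<open>x \<partial>\<^sub>\<rho>\<close> with \<open>x\<close> depending on \<open>r\<close>.
\<close>

definition radial_jacobi ::
  "(real \<Rightarrow> real) \<Rightarrow> (real \<Rightarrow> real) \<Rightarrow> (real \<Rightarrow> real) \<Rightarrow> real \<Rightarrow> (real \<Rightarrow> real) \<Rightarrow> real \<Rightarrow> real" where
  "radial_jacobi \<sigma> lam \<rho> k x = (\<lambda>r. deriv (deriv x) r + deriv \<sigma> r / \<sigma> r * deriv x r
     - k\<^sup>2 * deriv (\<lambda>s. lam s * deriv lam s) (\<rho> r) / (\<sigma> r)\<^sup>2 * x r)"

locale rotational_map =
  fixes I J :: "real set" and \<sigma> lam \<rho> :: "real \<Rightarrow> real" and k a :: real
  assumes open_I: "open I" and open_J: "open J"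
    and smooth_\<sigma>: "smooth_on I \<sigma>" and \<sigma>_pos: "\<forall>r\<in>I. \<sigma> r > 0"
    and smooth_lam: "smooth_on J lam" and lam_pos: "\<forall>s\<in>J. lam s > 0"
    and smooth_\<rho>: "smooth_on I \<rho>" and \<rho>_in: "\<forall>r\<in>I. \<rho> r \<in> J"
begin

abbreviation "g \<equiv> rot_metric \<sigma>"
abbreviation "h \<equiv> rot_metric lam"
abbreviation "\<phi> \<equiv> rot_map \<rho> k a"

lemma smooth_radial_tension: "smooth_on I (radial_tension \<sigma> lam \<rho> k)"
proof -
  have "smooth_expr I (\<lambda>r. deriv (deriv \<rho>) r + deriv \<sigma> r * inverse (\<sigma> r) * deriv \<rho> r
      + (- (k\<^sup>2)) * (lam (\<rho> r) * deriv lam (\<rho> r)) * (inverse (\<sigma> r) * inverse (\<sigma> r)))"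
    using \<sigma>_pos \<rho>_in open_I smooth_\<sigma> smooth_lam smooth_\<rho>
    by (intro smooth_expr.add smooth_expr.mult smooth_expr.inverse
        smooth_expr.compose[where T = J and f = lam] smooth_expr.compose[where T = J and f = "deriv lam"]
        smooth_expr.base smooth_on_deriv smooth_on_const) auto
  moreover have "radial_tension \<sigma> lam \<rho> k = (\<lambda>r. deriv (deriv \<rho>) r
      + deriv \<sigma> r * inverse (\<sigma> r) * deriv \<rho> r
      + (- (k\<^sup>2)) * (lam (\<rho> r) * deriv lam (\<rho> r)) * (inverse (\<sigma> r) * inverse (\<sigma> r)))"
    by (simp add: radial_tension_def divide_inverse power2_eq_square)
  ultimately show ?thesis
    using smooth_expr_imp_smooth_on[OF open_I] by simp
qed

lemma conn_form_domain:
  assumes "p \<in> rot_domain I"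
  shows "conn_form g p u v = vector [- \<sigma> (p $ 1) * deriv \<sigma> (p $ 1) * (u $ 2 * v $ 2),
    deriv \<sigma> (p $ 1) / \<sigma> (p $ 1) * (u $ 1 * v $ 2 + u $ 2 * v $ 1)]"
  using assms \<sigma>_pos
  by (intro conn_form_rot_metric smooth_on_has_real_derivative[OF smooth_\<sigma>])
    (auto simp: rot_domain_def)

lemma conn_form_target:
  assumes "p \<in> rot_domain I"
  shows "conn_form h (\<phi> p) u v =
    vector [- lam (\<rho> (p $ 1)) * deriv lam (\<rho> (p $ 1)) * (u $ 2 * v $ 2),
      deriv lam (\<rho> (p $ 1)) / lam (\<rho> (p $ 1)) * (u $ 1 * v $ 2 + u $ 2 * v $ 1)]"
proof -
  have "\<phi> p $ 1 = \<rho> (p $ 1)" "\<rho> (p $ 1) \<in> J" "lam (\<rho> (p $ 1)) \<noteq> 0"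
    using assms \<rho>_in lam_pos by (force simp: rot_map_def rot_domain_def)+
  then show ?thesis
    using conn_form_rot_metric[of lam "deriv lam (\<rho> (p $ 1))" "\<phi> p"]
      smooth_on_has_real_derivative[OF smooth_lam] by simp
qed

lemma push_forward_rot_map:
  assumes "p \<in> rot_domain I"
  shows "push_forward \<phi> X p = vector [deriv \<rho> (p $ 1) * X p $ 1, k * X p $ 2]"
  using assms frechet_derivative_rot_map[OF smooth_on_has_real_derivative[OF smooth_\<rho>]]
  by (simp add: push_forward_def rot_domain_def)

text \<open>
  Both components are again functions of \<open>r\<close> as soon as those of \<open>X\<close> are, so the lemma can be
  applied repeatedly.
\<close>

lemma nabla_along_radial:
  assumes "p \<in> rot_domain I"
    and V: "\<And>q. q \<in> rot_domain I \<Longrightarrow> V q = vector [x (q $ 1), y (q $ 1)]"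
    and "(x has_real_derivative x') (at (p $ 1))" "(y has_real_derivative y') (at (p $ 1))"
  shows "nabla_along h \<phi> X V p =
    vector [x' * X p $ 1 - k * lam (\<rho> (p $ 1)) * deriv lam (\<rho> (p $ 1)) * X p $ 2 * y (p $ 1),
      y' * X p $ 1 + deriv lam (\<rho> (p $ 1)) / lam (\<rho> (p $ 1)) *
        (deriv \<rho> (p $ 1) * X p $ 1 * y (p $ 1) + k * X p $ 2 * x (p $ 1))]"
proof -
  have "frechet_derivative V (at p) (X p) = vector [x' * X p $ 1, y' * X p $ 1]"
    using frechet_derivative_radial_field[OF open_I assms(1), of V x y] assms by blast
  then show ?thesis
    by (simp add: nabla_along_def conn_form_target[OF assms(1)] push_forward_rot_map[OF assms(1)]
        V[OF assms(1)] vec_eq_iff forall_2)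
qed

lemma nabla_coord_field:
  assumes "p \<in> rot_domain I"
  shows "nabla g (coord_field 1) (coord_field 1) p = 0"
    "nabla g (coord_field 2) (coord_field 2) p = vector [- \<sigma> (p $ 1) * deriv \<sigma> (p $ 1), 0]"
  by (simp_all add: nabla_def coord_field_def conn_form_domain[OF assms] vec_eq_iff forall_2 axis_def)

text \<open>
  The trace leaves the directions \<open>r\<close> and \<open>\<theta>\<close>. The first gives \<open>\<rho>''\<close>; the second gives
  \<open>- k\<^sup>2 \<lambda> \<lambda>'\<close> from the target and \<open>\<sigma> \<sigma>' \<rho>'\<close> from the domain, divided by \<open>\<sigma>\<^sup>2\<close>.
\<close>

lemma tension_rot_map:
  assumes p: "p \<in> rot_domain I"
  shows "tension g h \<phi> p = vector [radial_tension \<sigma> lam \<rho> k (p $ 1), 0]"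
proof -
  have r: "p $ 1 \<in> I" "\<sigma> (p $ 1) \<noteq> 0" using p \<sigma>_pos by (auto simp: rot_domain_def)
  have d: "(deriv \<rho> has_real_derivative deriv (deriv \<rho>) (p $ 1)) (at (p $ 1))"
    using smooth_on_has_real_derivative[OF smooth_on_deriv[OF smooth_\<rho>] r(1)] .
  have e1: "push_forward \<phi> (coord_field 1) q = vector [deriv \<rho> (q $ 1), 0]"
    and e2: "push_forward \<phi> (coord_field 2) q = vector [0, k]" if "q \<in> rot_domain I" for q
    using push_forward_rot_map[OF that] by (simp_all add: coord_field_def axis_def)
  have one: "nabla_along h \<phi> (coord_field 1) (push_forward \<phi> (coord_field 1)) p =
      vector [deriv (deriv \<rho>) (p $ 1), 0]"
    using nabla_along_radial[where V = "push_forward \<phi> (coord_field 1)"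
        and x = "deriv \<rho>" and y = "\<lambda>_. 0", OF p e1 d DERIV_const]
    by (simp add: coord_field_def axis_def)
  have two: "nabla_along h \<phi> (coord_field 2) (push_forward \<phi> (coord_field 2)) p =
      vector [- k\<^sup>2 * (lam (\<rho> (p $ 1)) * deriv lam (\<rho> (p $ 1))), 0]"
    using nabla_along_radial[where V = "push_forward \<phi> (coord_field 2)" and x = "\<lambda>_. 0" and y = "\<lambda>_. k",
        OF p e2 DERIV_const DERIV_const]
    by (simp add: coord_field_def axis_def power2_eq_square mult_ac)
  show ?thesis
    unfolding tension_def metric_trace_rot_metric[where \<sigma> = \<sigma>, OF r(2)] one two
      push_forward_rot_map[OF p] nabla_coord_field[OF p]
    using r(2)
    by (simp add: vec_eq_iff forall_2 radial_tension_def coord_field_def axis_def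
        power2_eq_square field_simps)
qed

text \<open>
  In direction \<open>\<theta>\<close>, the first covariant derivative of the tension field \<open>x \<partial>\<^sub>\<rho>\<close> is
  \<open>(\<lambda>' / \<lambda>) k x \<partial>\<^sub>\<phi>\<close>; deriving it again turns it back into a multiple of \<open>\<partial>\<^sub>\<rho>\<close>.
\<close>

lemma bitension_rot_map:
  assumes p: "p \<in> rot_domain I"
  shows "bitension g h \<phi> p =
    vector [radial_jacobi \<sigma> lam \<rho> k (radial_tension \<sigma> lam \<rho> k) (p $ 1), 0]"
proof -
  let ?x = "radial_tension \<sigma> lam \<rho> k" and ?r = "p $ 1"
  let ?W = "\<lambda>r. deriv lam (\<rho> r) / lam (\<rho> r) * (k * ?x r)"
  have r: "?r \<in> I" "\<sigma> ?r \<noteq> 0" "\<rho> ?r \<in> J" "lam (\<rho> ?r) \<noteq> 0"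
    using p \<sigma>_pos \<rho>_in lam_pos by (force simp: rot_domain_def)+
  note dx = smooth_on_has_real_derivative[OF smooth_radial_tension]
  note ddx = smooth_on_has_real_derivative[OF smooth_on_deriv[OF smooth_radial_tension]]
  note dlam = smooth_on_has_real_derivative[OF smooth_lam]
  note ddlam = smooth_on_has_real_derivative[OF smooth_on_deriv[OF smooth_lam]]
  note d\<rho> = smooth_on_has_real_derivative[OF smooth_\<rho>]
  have along: "nabla_along h \<phi> X (tension g h \<phi>) q =
      vector [deriv ?x (q $ 1) * X q $ 1, ?W (q $ 1) * X q $ 2]" if "q \<in> rot_domain I" for X q
  proof -
    have "q $ 1 \<in> I" using that by (simp add: rot_domain_def)
    then show ?thesis
      using nabla_along_radial[where V = "tension g h \<phi>" and x = ?x and y = "\<lambda>_. 0",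
          OF that tension_rot_map dx DERIV_const, of X] by (simp add: mult_ac)
  qed
  have one_field: "nabla_along h \<phi> (coord_field 1) (tension g h \<phi>) q = vector [deriv ?x (q $ 1), 0]"
    if "q \<in> rot_domain I" for q
    using along[OF that] by (simp add: coord_field_def axis_def)
  have one: "nabla_along h \<phi> (coord_field 1) (nabla_along h \<phi> (coord_field 1) (tension g h \<phi>)) p =
      vector [deriv (deriv ?x) ?r, 0]"
    using nabla_along_radial[where V = "nabla_along h \<phi> (coord_field 1) (tension g h \<phi>)"
        and x = "deriv ?x" and y = "\<lambda>_. 0",
        OF p one_field ddx[OF r(1)] DERIV_const]
    by (simp add: coord_field_def axis_def)
  have two_field: "nabla_along h \<phi> (coord_field 2) (tension g h \<phi>) q = vector [0, ?W (q $ 1)]"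
    if "q \<in> rot_domain I" for q
    using along[OF that] by (simp add: coord_field_def axis_def)
  \<comment> \<open>Differentiability suffices here, because \<open>W'\<close> gets multiplied by the \<open>r\<close>-component of
    \<open>\<partial>\<^sub>\<theta>\<close>, which is zero.\<close>
  obtain W' where W': "(?W has_real_derivative W') (at ?r)"
    using DERIV_mult[OF DERIV_divide[OF DERIV_chain2[OF ddlam[OF r(3)] d\<rho>[OF r(1)]]
          DERIV_chain2[OF dlam[OF r(3)] d\<rho>[OF r(1)]] r(4)] DERIV_cmult[OF dx[OF r(1)]]] by blast
  have two: "nabla_along h \<phi> (coord_field 2) (nabla_along h \<phi> (coord_field 2) (tension g h \<phi>)) p =
      vector [- k\<^sup>2 * (deriv lam (\<rho> ?r))\<^sup>2 * ?x ?r, 0]"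
    using nabla_along_radial[where V = "nabla_along h \<phi> (coord_field 2) (tension g h \<phi>)"
          and x = "\<lambda>_. 0" and y = ?W,
        OF p two_field DERIV_const W'] r(4)
    by (simp add: coord_field_def axis_def power2_eq_square mult_ac)
  have \<phi>p: "\<phi> p \<in> rot_domain J" "\<phi> p $ 1 = \<rho> ?r"
    using r by (simp_all add: rot_domain_def rot_map_def)
  note curv = curv_tensor_rot_metric[OF open_J smooth_lam lam_pos \<phi>p(1), unfolded \<phi>p(2)]
  \<comment> \<open>The two summands come from the second derivative in direction \<open>\<theta>\<close> and from the curvature.\<close>
  have "deriv (\<lambda>s. lam s * deriv lam s) (\<rho> ?r)
      = (deriv lam (\<rho> ?r))\<^sup>2 + lam (\<rho> ?r) * deriv (deriv lam) (\<rho> ?r)"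
    using DERIV_imp_deriv[OF DERIV_mult[OF dlam[OF r(3)] ddlam[OF r(3)]]]
    by (simp add: power2_eq_square mult.commute)
  then show ?thesis
    unfolding bitension_def metric_trace_rot_metric[where \<sigma> = \<sigma>, OF r(2)] one two along[OF p]
      push_forward_rot_map[OF p] nabla_coord_field[OF p] curv tension_rot_map[OF p]
    using r(2,4)
    by (simp add: vec_eq_iff forall_2 radial_jacobi_def coord_field_def axis_def
        power2_eq_square field_simps)
qed

lemma biharmonic_rot_map_iff:
  "biharmonic_on (rot_domain I) g h \<phi> \<longleftrightarrow>
    (\<forall>r\<in>I. radial_jacobi \<sigma> lam \<rho> k (radial_tension \<sigma> lam \<rho> k) r = 0)" (is "?L \<longleftrightarrow> ?R")
proof
  assume L: ?L
  show ?R
  proof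
    fix r assume "r \<in> I"
    then have "(vector [r, 0] :: real^2) \<in> rot_domain I" by (simp add: rot_domain_def)
    then have "bitension g h \<phi> (vector [r, 0]) $ 1 = 0"
      "bitension g h \<phi> (vector [r, 0]) $ 1 = radial_jacobi \<sigma> lam \<rho> k (radial_tension \<sigma> lam \<rho> k) r"
      using L by (simp add: biharmonic_on_def, simp add: bitension_rot_map)
    then show "radial_jacobi \<sigma> lam \<rho> k (radial_tension \<sigma> lam \<rho> k) r = 0" by simp
  qed
next
  assume ?R
  then show ?L
    unfolding biharmonic_on_def
    by (auto simp: bitension_rot_map rot_domain_def vec_eq_iff forall_2)
qed

text \<open>
  The unknown \<open>x\<close> of the system is only determined on \<open>I\<close>; as \<open>I\<close> is open, this determines its
  derivatives there.
\<close>

lemma biharmonic_rot_map_iff_system: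
  "biharmonic_on (rot_domain I) g h \<phi> \<longleftrightarrow>
    (\<exists>x. smooth_on I x \<and> (\<forall>r\<in>I. radial_jacobi \<sigma> lam \<rho> k x r = 0) \<and>
      (\<forall>r\<in>I. x r = radial_tension \<sigma> lam \<rho> k r))"
proof -
  let ?x = "radial_tension \<sigma> lam \<rho> k"
  have cong: "radial_jacobi \<sigma> lam \<rho> k ?x r = radial_jacobi \<sigma> lam \<rho> k x r"
    if x: "\<forall>r\<in>I. x r = ?x r" and r: "r \<in> I" for x r
  proof -
    have d: "deriv x s = deriv ?x s" if "s \<in> I" for s
      using x that by (intro deriv_cong_open[OF open_I]) blast+
    then have "deriv (deriv x) r = deriv (deriv ?x) r"
      using r by (rule deriv_cong_open[OF open_I, rotated])
    then show ?thesis using d x r by (simp add: radial_jacobi_def)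
  qed
  show ?thesis
  proof
    assume "biharmonic_on (rot_domain I) g h \<phi>"
    then have "\<forall>r\<in>I. radial_jacobi \<sigma> lam \<rho> k ?x r = 0"
      by (simp only: biharmonic_rot_map_iff)
    with smooth_radial_tension show "\<exists>x. smooth_on I x \<and>
        (\<forall>r\<in>I. radial_jacobi \<sigma> lam \<rho> k x r = 0) \<and> (\<forall>r\<in>I. x r = ?x r)"
      by (intro exI[of _ ?x]) simp
  next
    assume "\<exists>x. smooth_on I x \<and>
        (\<forall>r\<in>I. radial_jacobi \<sigma> lam \<rho> k x r = 0) \<and> (\<forall>r\<in>I. x r = ?x r)"
    then show "biharmonic_on (rot_domain I) g h \<phi>"
      using cong by (auto simp only: biharmonic_rot_map_iff)
  qed
qed

end

section \<open>Maps from the flat torus to the sphere\<close>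

text \<open>
  With \<open>x = \<rho>'' - (k\<^sup>2 / 2) sin (2 \<rho>)\<close> and \<open>(\<lambda> \<lambda>')' = cos (2 \<rho>)\<close>, the operator is
  \<open>x'' - k\<^sup>2 cos (2 \<rho>) x\<close>. Both parts contribute \<open>- k\<^sup>2 cos (2 \<rho>) \<rho>''\<close>, and the last term arises
  as \<open>(k\<^sup>4 / 2) sin (2 \<rho>) cos (2 \<rho>)\<close>.
\<close>

lemma radial_jacobi_torus_sphere:
  assumes "open I" "smooth_on I \<rho>" "r \<in> I"
  shows "radial_jacobi (\<lambda>_. 1) sin \<rho> k (radial_tension (\<lambda>_. 1) sin \<rho> k) r =
    (deriv ^^ 4) \<rho> r - 2 * k\<^sup>2 * cos (2 * \<rho> r) * (deriv ^^ 2) \<rho> r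
      + 2 * k\<^sup>2 * sin (2 * \<rho> r) * (deriv \<rho> r)\<^sup>2 + k^4 / 4 * sin (4 * \<rho> r)"
proof -
  have sin': "deriv sin = (cos :: real \<Rightarrow> real)"
    by (rule ext, rule DERIV_imp_deriv[OF DERIV_sin])
  let ?x = "radial_tension (\<lambda>_. 1) sin \<rho> k"
  have x: "?x = (\<lambda>r. deriv (deriv \<rho>) r - k\<^sup>2 / 2 * sin (2 * \<rho> r))"
    by (simp add: radial_tension_def sin' sin_double)
  note s1 = smooth_on_deriv[OF assms(2)]
  note s2 = smooth_on_deriv[OF s1]
  note s3 = smooth_on_deriv[OF s2]
  note d = assms(2)[THEN smooth_on_has_real_derivative] s1[THEN smooth_on_has_real_derivative]
    s2[THEN smooth_on_has_real_derivative] s3[THEN smooth_on_has_real_derivative]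
  have x': "deriv ?x s = deriv (deriv (deriv \<rho>)) s - k\<^sup>2 * cos (2 * \<rho> s) * deriv \<rho> s"
    if "s \<in> I" for s
    unfolding x using d[OF that]
    by (intro DERIV_imp_deriv) (auto intro!: derivative_eq_intros)
  have "deriv (deriv ?x) r =
      deriv (\<lambda>s. deriv (deriv (deriv \<rho>)) s - k\<^sup>2 * cos (2 * \<rho> s) * deriv \<rho> s) r"
    using x' by (intro deriv_cong_open[OF assms(1,3)])
  also have "\<dots> = deriv (deriv (deriv (deriv \<rho>))) r
      + 2 * k\<^sup>2 * sin (2 * \<rho> r) * (deriv \<rho> r)\<^sup>2 - k\<^sup>2 * cos (2 * \<rho> r) * deriv (deriv \<rho>) r"
    using d[OF assms(3)]
    by (intro DERIV_imp_deriv)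
      (auto intro!: derivative_eq_intros simp: power2_eq_square algebra_simps)
  finally have x'': "deriv (deriv ?x) r = \<dots>" .
  have "((\<lambda>s::real. sin s * deriv sin s) has_real_derivative cos (2 * \<rho> r)) (at (\<rho> r))"
    unfolding sin' by (auto intro!: derivative_eq_intros simp: cos_double power2_eq_square)
  then have q: "deriv (\<lambda>s::real. sin s * deriv sin s) (\<rho> r) = cos (2 * \<rho> r)"
    by (rule DERIV_imp_deriv)
  have four: "sin (4 * \<rho> r) = 2 * sin (2 * \<rho> r) * cos (2 * \<rho> r)"
    using sin_double[of "2 * \<rho> r"] by simp
  have iterates: "(deriv ^^ 4) \<rho> = deriv (deriv (deriv (deriv \<rho>)))" "(deriv ^^ 2) \<rho> = deriv (deriv \<rho>)"
    by (simp_all add: eval_nat_numeral)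
  have k4: "k ^ 4 = k\<^sup>2 * k\<^sup>2"
    by simp
  show ?thesis
    unfolding radial_jacobi_def x'' q four iterates k4
    by (simp add: x, simp add: algebra_simps)
qed

theorem corollary2p3:
  shows
  "(\<forall>(k::real) (a\<^sub>2::real) (I::real set) (J::real set)
       (\<sigma>::real \<Rightarrow> real) (lam::real \<Rightarrow> real) (\<rho>::real \<Rightarrow> real).
      open_interval I \<longrightarrow> open_interval J \<longrightarrow>
      smooth_on I \<sigma> \<longrightarrow> (\<forall>r\<in>I. \<sigma> r > 0) \<longrightarrow>
      smooth_on J lam \<longrightarrow> (\<forall>s\<in>J. lam s > 0) \<longrightarrow>
      smooth_on I \<rho> \<longrightarrow> (\<forall>r\<in>I. \<rho> r \<in> J) \<longrightarrow>
      (let \<tau>1 = (\<lambda>r \<theta>. tension (rot_metric \<sigma>) (rot_metric lam) (rot_map \<rho> k a\<^sub>2) (vector [r, \<theta>]) $ 1);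
           F = (\<lambda>r. deriv (deriv \<rho>) r + deriv \<sigma> r / \<sigma> r * deriv \<rho> r
                      - k\<^sup>2 * (lam (\<rho> r) * deriv lam (\<rho> r)) / (\<sigma> r)\<^sup>2)
       in (\<forall>r\<in>I. \<forall>\<theta>. \<tau>1 r \<theta> = F r) \<and>
          (biharmonic_on (rot_domain I) (rot_metric \<sigma>) (rot_metric lam) (rot_map \<rho> k a\<^sub>2) \<longleftrightarrow>
             (\<exists>x::real \<Rightarrow> real. smooth_on I x \<and>
                (\<forall>r\<in>I. deriv (deriv x) r + deriv \<sigma> r / \<sigma> r * deriv x r
                   - k\<^sup>2 * deriv (\<lambda>s. lam s * deriv lam s) (\<rho> r) / (\<sigma> r)\<^sup>2 * x r = 0) \<and>
                (\<forall>r\<in>I. \<forall>\<theta>. x r = \<tau>1 r \<theta>) \<and>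
                (\<forall>r\<in>I. x r = F r)))))
   \<and>
   (\<forall>(k::real) (I::real set) (\<rho>::real \<Rightarrow> real).
      open_interval I \<longrightarrow> smooth_on I \<rho> \<longrightarrow> (\<forall>r\<in>I. \<rho> r \<in> {0<..<pi}) \<longrightarrow>
      (biharmonic_on (rot_domain I) (rot_metric (\<lambda>_. 1)) (rot_metric sin) (rot_map \<rho> k 0) \<longleftrightarrow>
         (\<forall>r\<in>I. (deriv ^^ 4) \<rho> r - 2 * k\<^sup>2 * cos (2 * \<rho> r) * (deriv ^^ 2) \<rho> r
            + 2 * k\<^sup>2 * sin (2 * \<rho> r) * (deriv \<rho> r)\<^sup>2
            + k^4 / 4 * sin (4 * \<rho> r) = 0)))"
proof (intro conjI allI impI)
  fix k a\<^sub>2 :: real and I J :: "real set" and \<sigma> lam \<rho> :: "real \<Rightarrow> real"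
  assume "open_interval I" "open_interval J" "smooth_on I \<sigma>" "\<forall>r\<in>I. \<sigma> r > 0"
    "smooth_on J lam" "\<forall>s\<in>J. lam s > 0" "smooth_on I \<rho>" "\<forall>r\<in>I. \<rho> r \<in> J"
  then interpret rotational_map I J \<sigma> lam \<rho> k a\<^sub>2
    by unfold_locales (auto simp: open_interval_def)
  have \<tau>1: "tension g h \<phi> (vector [r, \<theta>]) $ 1 = radial_tension \<sigma> lam \<rho> k r" if "r \<in> I" for r \<theta>
    using tension_rot_map[of "vector [r, \<theta>]"] that by (simp add: rot_domain_def)
  show "let \<tau>1 = (\<lambda>r \<theta>. tension g h \<phi> (vector [r, \<theta>]) $ 1);
          F = (\<lambda>r. deriv (deriv \<rho>) r + deriv \<sigma> r / \<sigma> r * deriv \<rho> r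
                 - k\<^sup>2 * (lam (\<rho> r) * deriv lam (\<rho> r)) / (\<sigma> r)\<^sup>2)
        in (\<forall>r\<in>I. \<forall>\<theta>. \<tau>1 r \<theta> = F r) \<and>
          (biharmonic_on (rot_domain I) g h \<phi> \<longleftrightarrow>
             (\<exists>x. smooth_on I x \<and>
                (\<forall>r\<in>I. deriv (deriv x) r + deriv \<sigma> r / \<sigma> r * deriv x r
                   - k\<^sup>2 * deriv (\<lambda>s. lam s * deriv lam s) (\<rho> r) / (\<sigma> r)\<^sup>2 * x r = 0) \<and>
                (\<forall>r\<in>I. \<forall>\<theta>. x r = \<tau>1 r \<theta>) \<and>
                (\<forall>r\<in>I. x r = F r)))"
    unfolding biharmonic_rot_map_iff_system
    by (simp only: Let_def \<tau>1 radial_jacobi_def radial_tension_def simp_thms ball_triv cong: ball_cong)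
next
  fix k :: real and I :: "real set" and \<rho> :: "real \<Rightarrow> real"
  assume I: "open_interval I" and \<rho>: "smooth_on I \<rho>" "\<forall>r\<in>I. \<rho> r \<in> {0<..<pi}"
  then interpret rotational_map I "{0<..<pi}" "\<lambda>_. 1" sin \<rho> k 0
    by unfold_locales (auto simp: open_interval_def smooth_on_const smooth_on_sin sin_gt_zero)
  show "biharmonic_on (rot_domain I) (rot_metric (\<lambda>_. 1)) (rot_metric sin) (rot_map \<rho> k 0) \<longleftrightarrow>
      (\<forall>r\<in>I. (deriv ^^ 4) \<rho> r - 2 * k\<^sup>2 * cos (2 * \<rho> r) * (deriv ^^ 2) \<rho> r
            + 2 * k\<^sup>2 * sin (2 * \<rho> r) * (deriv \<rho> r)\<^sup>2
            + k^4 / 4 * sin (4 * \<rho> r) = 0)"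
    using biharmonic_rot_map_iff radial_jacobi_torus_sphere[OF open_I \<rho>(1)] by simp
qed

end
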